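(* For every prime $p\geq 3$ there exist a group $G$ of order $p^8$ and a non-degenerate class $[c]\in H^2(G,\mathbb{C}^* )$ which admits both (1) a normal Lagrangian $H\vartriangleleft G$ (of order $p^4$), and (2) a normal isotropic subgroup of $G$ of order $p^3$ which is not contained in any normal Lagrangian.
   Context: $\mathbb{C}^*$ is regarded as a trivial $G$-module. A 2-cocycle $c\in Z^2(G,\mathbb{C}^* )$ is a map $c:G\times G\to\mathbb{C}^*$ with $c(g,h)c(gh,k)=c(g,hk)c(h,k)$ for all $g,h,k\in G$, and $[c]$ denotes its cohomology class. A subgroup $H$ of $G$ is isotropic with respect to $[c]$ if $\mathrm{res}^G_H[c]=0$ in $H^2(H,\mathbb{C}^* )$. The class $[c]$ (or the cocycle $c$) is non-degenerate if for every $x\in G$ with $x\neq e$ there is $g\in C_G(x)$ such that $c(x,g)\neq c(g,x)$; this depends only on the class $[c]$. A Lagrangian with respect to a non-degenerate class $[c]$ is a subgroup $H$ of $G$ which is isotropic with respect to $[c]$ and satisfies $|H|=\sqrt{|G|}$; a normal Lagrangian is a Lagrangian which is a normal subgroup of $G$. In the claim, "isotropic" and "Lagrangian" are with respect to the class $[c]$. *)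

theory Defs
  imports "HOL-Algebra.Coset" "HOL-Computational_Algebra.Primes" "HOL.Complex"
begin

text \<open>
  Cochains with values in the trivial module \<open>\<complex>\<^sup>*\<close> are modelled by extensional functions on
  \<open>carrier G \<times> carrier G\<close>, so that equality of cochains is equality of functions.
  Neither cocycles nor coboundaries are assumed to be normalised.
\<close>

definition cochain_group2 :: "('a, 'b) monoid_scheme \<Rightarrow> ('a \<times> 'a \<Rightarrow> complex) monoid" where
  "cochain_group2 G =
    \<lparr>carrier = (carrier G \<times> carrier G) \<rightarrow>\<^sub>E (UNIV - {0}),
     monoid.mult = (\<lambda>c d. restrict (\<lambda>x. c x * d x) (carrier G \<times> carrier G)),
     one = restrict (\<lambda>_. 1) (carrier G \<times> carrier G)\<rparr>"

definition cocycles2 :: "('a, 'b) monoid_scheme \<Rightarrow> ('a \<times> 'a \<Rightarrow> complex) set" where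
  "cocycles2 G =
    {c \<in> carrier (cochain_group2 G).
      \<forall>g\<in>carrier G. \<forall>h\<in>carrier G. \<forall>k\<in>carrier G.
        c (g, h) * c (g \<otimes>\<^bsub>G\<^esub> h, k) = c (g, h \<otimes>\<^bsub>G\<^esub> k) * c (h, k)}"

definition Z2 :: "('a, 'b) monoid_scheme \<Rightarrow> ('a \<times> 'a \<Rightarrow> complex) monoid" where
  "Z2 G = (cochain_group2 G)\<lparr>carrier := cocycles2 G\<rparr>"

definition coboundary2 :: "('a, 'b) monoid_scheme \<Rightarrow> ('a \<Rightarrow> complex) \<Rightarrow> 'a \<times> 'a \<Rightarrow> complex" where
  "coboundary2 G f =
    restrict (\<lambda>(g, h). f g * f h / f (g \<otimes>\<^bsub>G\<^esub> h)) (carrier G \<times> carrier G)"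

definition B2 :: "('a, 'b) monoid_scheme \<Rightarrow> ('a \<times> 'a \<Rightarrow> complex) set" where
  "B2 G = coboundary2 G ` (carrier G \<rightarrow> UNIV - {0})"

definition H2 :: "('a, 'b) monoid_scheme \<Rightarrow> ('a \<times> 'a \<Rightarrow> complex) set monoid" where
  "H2 G = Z2 G Mod B2 G"

definition cohomology_class ::
    "('a, 'b) monoid_scheme \<Rightarrow> ('a \<times> 'a \<Rightarrow> complex) \<Rightarrow> ('a \<times> 'a \<Rightarrow> complex) set" where
  "cohomology_class G c = B2 G #>\<^bsub>Z2 G\<^esub> c"

text \<open>
  The restriction map on classes.  All members of the union are equal when \<open>\<gamma>\<close> is an element of
  \<open>H2 G\<close>; see \<open>res2_class\<close> below.
\<close>

definition res2 ::
    "('a, 'b) monoid_scheme \<Rightarrow> 'a set \<Rightarrow> ('a \<times> 'a \<Rightarrow> complex) set \<Rightarrow> ('a \<times> 'a \<Rightarrow> complex) set" where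
  "res2 G H \<gamma> = (\<Union>c\<in>\<gamma>. cohomology_class (G\<lparr>carrier := H\<rparr>) (restrict c (H \<times> H)))"

definition isotropic ::
    "('a, 'b) monoid_scheme \<Rightarrow> ('a \<times> 'a \<Rightarrow> complex) set \<Rightarrow> 'a set \<Rightarrow> bool" where
  "isotropic G \<gamma> H \<longleftrightarrow> subgroup H G \<and> res2 G H \<gamma> = \<one>\<^bsub>H2 (G\<lparr>carrier := H\<rparr>)\<^esub>"

definition group_centralizer :: "('a, 'b) monoid_scheme \<Rightarrow> 'a \<Rightarrow> 'a set" where
  "group_centralizer G x = {g \<in> carrier G. g \<otimes>\<^bsub>G\<^esub> x = x \<otimes>\<^bsub>G\<^esub> g}"

definition nondegenerate :: "('a, 'b) monoid_scheme \<Rightarrow> ('a \<times> 'a \<Rightarrow> complex) \<Rightarrow> bool" where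
  "nondegenerate G c \<longleftrightarrow>
    (\<forall>x\<in>carrier G. x \<noteq> \<one>\<^bsub>G\<^esub> \<longrightarrow> (\<exists>g\<in>group_centralizer G x. c (x, g) \<noteq> c (g, x)))"

text \<open>
  Only applied to the class of a non-degenerate cocycle.
\<close>

definition Lagrangian ::
    "('a, 'b) monoid_scheme \<Rightarrow> ('a \<times> 'a \<Rightarrow> complex) set \<Rightarrow> 'a set \<Rightarrow> bool" where
  "Lagrangian G \<gamma> H \<longleftrightarrow> isotropic G \<gamma> H \<and> real (card H) = sqrt (real (order G))"

definition normal_Lagrangian ::
    "('a, 'b) monoid_scheme \<Rightarrow> ('a \<times> 'a \<Rightarrow> complex) set \<Rightarrow> 'a set \<Rightarrow> bool" where
  "normal_Lagrangian G \<gamma> H \<longleftrightarrow> Lagrangian G \<gamma> H \<and> H \<lhd> G"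


lemma carrier_Z2: "carrier (Z2 G) = cocycles2 G"
  by (simp add: Z2_def)

lemma comm_group_cochain_group2: "comm_group (cochain_group2 G)"
proof (rule comm_groupI)
  fix c assume c: "c \<in> carrier (cochain_group2 G)"
  show "\<exists>d\<in>carrier (cochain_group2 G). d \<otimes>\<^bsub>cochain_group2 G\<^esub> c = \<one>\<^bsub>cochain_group2 G\<^esub>"
    by (rule bexI[of _ "restrict (\<lambda>x. inverse (c x)) (carrier G \<times> carrier G)"])
       (use c in \<open>auto simp: cochain_group2_def fun_eq_iff restrict_def PiE_iff extensional_def\<close>)
qed (auto simp: cochain_group2_def fun_eq_iff restrict_def PiE_iff extensional_def mult_ac)

lemma inv_cochain_group2:
  assumes "c \<in> carrier (cochain_group2 G)"
  shows "inv\<^bsub>cochain_group2 G\<^esub> c = restrict (\<lambda>x. inverse (c x)) (carrier G \<times> carrier G)"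
proof -
  interpret comm_group "cochain_group2 G" by (rule comm_group_cochain_group2)
  show ?thesis
    by (rule inv_equality)
       (use assms in \<open>auto simp: cochain_group2_def fun_eq_iff restrict_def PiE_iff extensional_def\<close>)
qed

lemma (in group) subgroup_cocycles2: "subgroup (cocycles2 G) (cochain_group2 G)"
proof -
  interpret C: comm_group "cochain_group2 G" by (rule comm_group_cochain_group2)
  show ?thesis
  proof (rule C.subgroupI)
    show "cocycles2 G \<subseteq> carrier (cochain_group2 G)"
      by (auto simp: cocycles2_def)
    have "\<one>\<^bsub>cochain_group2 G\<^esub> \<in> cocycles2 G"
      by (auto simp: cocycles2_def cochain_group2_def)
    then show "cocycles2 G \<noteq> {}" by blast
  next
    fix c assume c: "c \<in> cocycles2 G"
    then have "inv\<^bsub>cochain_group2 G\<^esub> c \<in> carrier (cochain_group2 G)"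
      by (auto simp: cocycles2_def)
    with c show "inv\<^bsub>cochain_group2 G\<^esub> c \<in> cocycles2 G"
      by (auto simp: cocycles2_def inv_cochain_group2 simp flip: inverse_mult_distrib)
  next
    fix c d assume cd: "c \<in> cocycles2 G" "d \<in> cocycles2 G"
    then have "c \<otimes>\<^bsub>cochain_group2 G\<^esub> d \<in> carrier (cochain_group2 G)"
      by (auto simp: cocycles2_def)
    moreover have "(c (g, h) * d (g, h)) * (c (g \<otimes> h, k) * d (g \<otimes> h, k)) =
        (c (g, h \<otimes> k) * d (g, h \<otimes> k)) * (c (h, k) * d (h, k))"
      if "g \<in> carrier G" "h \<in> carrier G" "k \<in> carrier G" for g h k
    proof -
      have "(c (g, h) * d (g, h)) * (c (g \<otimes> h, k) * d (g \<otimes> h, k)) =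
          (c (g, h) * c (g \<otimes> h, k)) * (d (g, h) * d (g \<otimes> h, k))"
        by (simp add: mult_ac)
      also have "\<dots> = (c (g, h \<otimes> k) * c (h, k)) * (d (g, h \<otimes> k) * d (h, k))"
        using cd that by (simp add: cocycles2_def)
      finally show ?thesis by (simp add: mult_ac)
    qed
    ultimately show "c \<otimes>\<^bsub>cochain_group2 G\<^esub> d \<in> cocycles2 G"
      by (auto simp: cocycles2_def) (auto simp: cochain_group2_def)
  qed
qed

lemma (in group) comm_group_Z2: "comm_group (Z2 G)"
proof -
  interpret C: comm_group "cochain_group2 G" by (rule comm_group_cochain_group2)
  have "group (Z2 G)"
    unfolding Z2_def by (rule C.subgroup_imp_group[OF subgroup_cocycles2])
  then show ?thesis
    by (rule group.group_comm_groupI)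
       (use subgroup.subset[OF subgroup_cocycles2] in \<open>auto simp: Z2_def intro: C.m_comm\<close>)
qed

lemma (in group) coboundary2_in_cocycles2:
  assumes "f \<in> carrier G \<rightarrow> UNIV - {0}"
  shows "coboundary2 G f \<in> cocycles2 G"
proof -
  have nz: "f x \<noteq> 0" if "x \<in> carrier G" for x
    using assms that by auto
  show ?thesis
    by (auto simp: cocycles2_def cochain_group2_def coboundary2_def nz m_assoc field_simps)
qed

lemma (in group) subgroup_B2: "subgroup (B2 G) (Z2 G)"
proof -
  interpret Z: comm_group "Z2 G" by (rule comm_group_Z2)
  show ?thesis
  proof (rule Z.subgroupI)
    show "B2 G \<subseteq> carrier (Z2 G)"
      by (auto simp: B2_def carrier_Z2 intro: coboundary2_in_cocycles2)
    show "B2 G \<noteq> {}"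
    proof -
      have "(\<lambda>_. 1 :: complex) \<in> carrier G \<rightarrow> UNIV - {0}" by simp
      then show ?thesis unfolding B2_def by blast
    qed
  next
    fix b assume "b \<in> B2 G"
    then obtain f where f: "f \<in> carrier G \<rightarrow> UNIV - {0}" "b = coboundary2 G f"
      by (auto simp: B2_def)
    have b: "b \<in> cocycles2 G" using f coboundary2_in_cocycles2 by simp
    have "inv\<^bsub>Z2 G\<^esub> b = inv\<^bsub>cochain_group2 G\<^esub> b"
      unfolding Z2_def
      using comm_group_cochain_group2 b subgroup_cocycles2
      by (intro group.m_inv_consistent) (auto simp: comm_group_def)
    also have "\<dots> = restrict (\<lambda>x. inverse (b x)) (carrier G \<times> carrier G)"
      using b by (intro inv_cochain_group2) (auto simp: cocycles2_def)
    also have "\<dots> = coboundary2 G (\<lambda>x. inverse (f x))"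
      by (auto simp: f coboundary2_def fun_eq_iff restrict_def field_simps)
    also have "\<dots> \<in> B2 G"
      unfolding B2_def using f by (intro imageI) auto
    finally show "inv\<^bsub>Z2 G\<^esub> b \<in> B2 G" .
  next
    fix b b' assume "b \<in> B2 G" "b' \<in> B2 G"
    then obtain f f' where f: "f \<in> carrier G \<rightarrow> UNIV - {0}" "b = coboundary2 G f"
        and f': "f' \<in> carrier G \<rightarrow> UNIV - {0}" "b' = coboundary2 G f'"
      by (auto simp: B2_def)
    have "b \<otimes>\<^bsub>Z2 G\<^esub> b' = coboundary2 G (\<lambda>x. f x * f' x)"
      by (auto simp: f f' Z2_def cochain_group2_def coboundary2_def fun_eq_iff restrict_def)
    also have "\<dots> \<in> B2 G"
      unfolding B2_def using f f' by (intro imageI) auto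
    finally show "b \<otimes>\<^bsub>Z2 G\<^esub> b' \<in> B2 G" .
  qed
qed

lemma (in group) comm_group_H2: "comm_group (H2 G)"
  unfolding H2_def by (intro comm_group.abelian_FactGroup comm_group_Z2 subgroup_B2)

lemma (in group) cohomology_class_eq_iff:
  assumes "c \<in> cocycles2 G" "d \<in> cocycles2 G"
  shows "cohomology_class G c = cohomology_class G d \<longleftrightarrow>
    (\<exists>f \<in> carrier G \<rightarrow> UNIV - {0}. \<forall>g\<in>carrier G. \<forall>h\<in>carrier G.
       c (g, h) = f g * f h / f (g \<otimes> h) * d (g, h))"
proof -
  interpret Z: comm_group "Z2 G" by (rule comm_group_Z2)
  have "cohomology_class G c = cohomology_class G d \<longleftrightarrow> c \<in> B2 G #>\<^bsub>Z2 G\<^esub> d"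
    unfolding cohomology_class_def
    by (metis Z.rcos_self Z.repr_independence assms carrier_Z2 subgroup_B2)
  also have "\<dots> \<longleftrightarrow> (\<exists>f \<in> carrier G \<rightarrow> UNIV - {0}. c = coboundary2 G f \<otimes>\<^bsub>Z2 G\<^esub> d)"
    by (auto simp: r_coset_def B2_def)
  also have "\<dots> \<longleftrightarrow> (\<exists>f \<in> carrier G \<rightarrow> UNIV - {0}. \<forall>g\<in>carrier G. \<forall>h\<in>carrier G.
       c (g, h) = f g * f h / f (g \<otimes> h) * d (g, h))"
  proof (rule bex_cong[OF refl])
    fix f
    have "c \<in> extensional (carrier G \<times> carrier G)"
      using assms by (auto simp: cocycles2_def cochain_group2_def PiE_iff)
    then show "c = coboundary2 G f \<otimes>\<^bsub>Z2 G\<^esub> d \<longleftrightarrow> (\<forall>g\<in>carrier G. \<forall>h\<in>carrier G.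
       c (g, h) = f g * f h / f (g \<otimes> h) * d (g, h))"
      by (auto simp: Z2_def cochain_group2_def coboundary2_def fun_eq_iff restrict_def
          extensional_def)
  qed
  finally show ?thesis .
qed

lemma restrict_cocycles2:
  assumes "c \<in> cocycles2 G" "subgroup H G"
  shows "restrict c (H \<times> H) \<in> cocycles2 (G\<lparr>carrier := H\<rparr>)"
proof -
  interpret subgroup H G by fact
  show ?thesis
    using assms(1) subset
    by (auto simp: cocycles2_def cochain_group2_def PiE_iff subset_iff)
qed

lemma (in group) res2_class:
  assumes c: "c \<in> cocycles2 G" and H: "subgroup H G"
  shows "res2 G H (cohomology_class G c) =
    cohomology_class (G\<lparr>carrier := H\<rparr>) (restrict c (H \<times> H))"
proof -
  interpret Z: comm_group "Z2 G" by (rule comm_group_Z2)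
  interpret K: group "G\<lparr>carrier := H\<rparr>" by (rule subgroup.subgroup_is_group[OF H is_group])
  have "cohomology_class (G\<lparr>carrier := H\<rparr>) (restrict d (H \<times> H)) =
      cohomology_class (G\<lparr>carrier := H\<rparr>) (restrict c (H \<times> H))"
    if d: "d \<in> cohomology_class G c" for d
  proof -
    have dZ: "d \<in> cocycles2 G"
      using d c Z.r_coset_subset_G[OF subgroup.subset[OF subgroup_B2]]
      unfolding cohomology_class_def carrier_Z2 by blast
    have "cohomology_class G d = cohomology_class G c"
      using d c unfolding cohomology_class_def
      by (metis Z.repr_independence carrier_Z2 subgroup_B2)
    then obtain f where f: "f \<in> carrier G \<rightarrow> UNIV - {0}"
        "\<forall>g\<in>carrier G. \<forall>h\<in>carrier G. d (g, h) = f g * f h / f (g \<otimes> h) * c (g, h)"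
      using cohomology_class_eq_iff[OF dZ c] by blast
    then show ?thesis
      using subgroup.subset[OF H] dZ c H
      by (subst K.cohomology_class_eq_iff)
         (auto intro!: restrict_cocycles2 bexI[of _ f])
  qed
  moreover have "c \<in> cohomology_class G c"
    unfolding cohomology_class_def using c by (intro Z.rcos_self subgroup_B2) (simp add: carrier_Z2)
  ultimately show ?thesis unfolding res2_def by blast
qed

lemma (in group) isotropic_class_iff:
  assumes c: "c \<in> cocycles2 G"
  shows "isotropic G (cohomology_class G c) H \<longleftrightarrow>
    subgroup H G \<and> (\<exists>f \<in> H \<rightarrow> UNIV - {0}. \<forall>g\<in>H. \<forall>h\<in>H. c (g, h) = f g * f h / f (g \<otimes> h))"
proof (cases "subgroup H G")
  case H: True
  interpret K: group "G\<lparr>carrier := H\<rparr>" by (rule subgroup.subgroup_is_group[OF H is_group])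
  interpret ZK: comm_group "Z2 (G\<lparr>carrier := H\<rparr>)" by (rule K.comm_group_Z2)
  let ?one = "\<one>\<^bsub>Z2 (G\<lparr>carrier := H\<rparr>)\<^esub>"
  have 1: "?one \<in> cocycles2 (G\<lparr>carrier := H\<rparr>)"
    using ZK.one_closed by (simp add: carrier_Z2)
  have "cohomology_class (G\<lparr>carrier := H\<rparr>) ?one = \<one>\<^bsub>H2 (G\<lparr>carrier := H\<rparr>)\<^esub>"
    unfolding cohomology_class_def H2_def
    using ZK.coset_mult_one[OF subgroup.subset[OF K.subgroup_B2]] by simp
  then have "isotropic G (cohomology_class G c) H \<longleftrightarrow>
      cohomology_class (G\<lparr>carrier := H\<rparr>) (restrict c (H \<times> H)) =
      cohomology_class (G\<lparr>carrier := H\<rparr>) ?one"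
    unfolding isotropic_def res2_class[OF c H] using H by simp
  also have "\<dots> \<longleftrightarrow> (\<exists>f \<in> H \<rightarrow> UNIV - {0}. \<forall>g\<in>H. \<forall>h\<in>H. c (g, h) = f g * f h / f (g \<otimes> h))"
    by (subst K.cohomology_class_eq_iff[OF restrict_cocycles2[OF c H] 1])
       (simp add: Z2_def cochain_group2_def)
  finally show ?thesis using H by simp
qed (simp add: isotropic_def)

lemma (in group) nondegenerate_cong_class:
  assumes "c \<in> cocycles2 G" "d \<in> cocycles2 G" "cohomology_class G c = cohomology_class G d"
  shows "nondegenerate G c \<longleftrightarrow> nondegenerate G d"
proof -
  obtain f where f: "f \<in> carrier G \<rightarrow> UNIV - {0}"
      "\<forall>g\<in>carrier G. \<forall>h\<in>carrier G. c (g, h) = f g * f h / f (g \<otimes> h) * d (g, h)"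
    using assms cohomology_class_eq_iff by blast
  have nz: "f x \<noteq> 0" if "x \<in> carrier G" for x
    using f that by auto
  have "c (x, g) = c (g, x) \<longleftrightarrow> d (x, g) = d (g, x)"
    if "x \<in> carrier G" "g \<in> group_centralizer G x" for x g
    using that f nz by (auto simp: group_centralizer_def)
  then show ?thesis unfolding nondegenerate_def by blast
qed

end

theory Submission
  imports Defs "HOL-Library.Countable"
begin

text \<open>
  The example comes from linear algebra: a nilpotent Lie algebra of class 2 over \<open>\<int>/p\<close> with a
  symplectic form that is a 2-cocycle.  It has generators \<open>z\<close>, \<open>l\<^sub>1\<close>, \<open>l\<^sub>2\<close>, \<open>e\<^sub>1\<close>, \<open>e\<^sub>2\<close> and central
  elements \<open>e\<^sub>3\<close>, \<open>z\<^sub>1\<close>, \<open>z\<^sub>2\<close>, with brackets \<open>[l\<^sub>i, e\<^sub>i] = e\<^sub>3\<close> and \<open>[z, l\<^sub>i] = z\<^sub>i\<close>; the form pairs \<open>z\<close> with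
  \<open>e\<^sub>3\<close>, \<open>z\<^sub>i\<close> with \<open>e\<^sub>i\<close>, and \<open>l\<^sub>1\<close> with \<open>l\<^sub>2\<close>.  With coordinates \<open>s\<close> for \<open>z\<close>, \<open>a \<in> (\<int>/p)\<^sup>2\<close> for the \<open>l\<^sub>i\<close>,
  \<open>b \<in> (\<int>/p)\<^sup>2\<close> for the \<open>e\<^sub>i\<close>, \<open>t\<close> for \<open>e\<^sub>3\<close> and \<open>u \<in> (\<int>/p)\<^sup>2\<close> for the \<open>z\<^sub>i\<close>, the corresponding group of
  order \<open>p\<^sup>8\<close> has the product
  \<open>(s, a, b, t, u) (s', a', b', t', u') = (s + s', a + a', b + b', t + t' + a \<cdot> b', u + u' + s a')\<close>,
  and \<open>f(x, x') = s t' + u \<cdot> b' + a\<^sub>1 a'\<^sub>2\<close> is an additive 2-cocycle: the defects of the first two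
  summands are \<open>s (a' \<cdot> b'')\<close> and \<open>- s (a' \<cdot> b'')\<close>, and the third summand is bilinear.  The cocycle
  of the theorem is \<open>c = \<zeta>\<^sup>f\<close> for a primitive \<open>p\<close>-th root of unity \<open>\<zeta>\<close>.

  Each nonzero coordinate of an element is detected by the commutator pairing
  \<open>f(x, y) - f(y, x)\<close> with a suitable unit vector \<open>y\<close> that commutes with \<open>x\<close>, so \<open>c\<close> is
  non-degenerate.  The subgroup \<open>s = b = a\<^sub>2 = 0\<close> is normal of order \<open>p\<^sup>4\<close>, and \<open>f\<close> vanishes on it; so
  it is a normal Lagrangian.  The subgroup \<open>N\<close> given by \<open>s = a = u = 0\<close> is normal of order \<open>p\<^sup>3\<close>, and
  \<open>f\<close> vanishes on it too.

  No normal isotropic subgroup properly contains \<open>N\<close>.  On an isotropic subgroup \<open>L\<close> the cocycle is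
  a coboundary, hence symmetric on commuting pairs.  Let \<open>N \<subseteq> L\<close> be normal and isotropic, and \<open>x \<in> L\<close>.
  Pairing \<open>x\<close> with the central element \<open>e\<^sub>3 \<in> N\<close> gives \<open>s = 0\<close>.  Normality puts the commutator \<open>[z, x]\<close>
  into \<open>L\<close>; it is central with \<open>u\<close>-coordinate \<open>a\<close>, so pairing it with the \<open>e\<^sub>i \<in> N\<close> gives \<open>a = 0\<close>.  Now
  \<open>x\<close> commutes with \<open>N\<close>, and pairing it with the \<open>e\<^sub>i\<close> gives \<open>u = 0\<close>.  So \<open>x \<in> N\<close>.
\<close>

section \<open>Isotropic subgroups\<close>

text \<open>
  A coboundary \<open>f g * f h / f (g \<otimes> h)\<close> is symmetric on commuting pairs.
\<close>
lemma (in group) isotropic_imp_symmetric_on_commuting: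
  assumes "c \<in> cocycles2 G" "isotropic G (cohomology_class G c) L"
    and "x \<in> L" "y \<in> L" "x \<otimes> y = y \<otimes> x"
  shows "c (x, y) = c (y, x)"
proof -
  obtain f :: "'a \<Rightarrow> complex" where "\<forall>g\<in>L. \<forall>h\<in>L. c (g, h) = f g * f h / f (g \<otimes> h)"
    using assms(1,2) by (auto simp: isotropic_class_iff)
  then show ?thesis
    using assms(3-5) by (simp add: mult.commute)
qed

lemma (in group) isotropic_if_trivial_on:
  assumes "c \<in> cocycles2 G" "subgroup H G" "\<And>g h. g \<in> H \<Longrightarrow> h \<in> H \<Longrightarrow> c (g, h) = 1"
  shows "isotropic G (cohomology_class G c) H"
  using assms by (auto simp: isotropic_class_iff intro!: bexI[of _ "\<lambda>_. 1"])

lemma (in group) normal_if_conjugation_closed: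
  assumes "subgroup H G"
    and "\<And>g h. g \<in> carrier G \<Longrightarrow> h \<in> H \<Longrightarrow> \<exists>h'\<in>H. g \<otimes> h = h' \<otimes> g"
  shows "H \<lhd> G"
proof -
  interpret H: subgroup H G by fact
  have "g \<otimes> h \<otimes> inv g \<in> H" if "g \<in> carrier G" "h \<in> H" for g h
  proof -
    obtain h' where h': "h' \<in> H" "g \<otimes> h = h' \<otimes> g"
      using assms(2)[OF \<open>g \<in> carrier G\<close> \<open>h \<in> H\<close>] by blast
    then have "g \<otimes> h \<otimes> inv g = h'"
      using \<open>g \<in> carrier G\<close> by (simp add: m_assoc)
    with h' show ?thesis by simp
  qed
  with assms(1) show ?thesis by (simp add: normal_inv_iff)
qed

text \<open>
  Here \<open>w\<close> is the commutator \<open>(g \<otimes> x \<otimes> inv g) \<otimes> inv x\<close>, a conjugate of \<open>x\<close> times the inverse of \<open>x\<close>.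
  The equation that characterises it contains no inverses, so it can be checked on coordinates.
\<close>
lemma (in group) commutator_in_normal:
  assumes "L \<lhd> G" "x \<in> L" "g \<in> carrier G" "w \<in> carrier G" "w \<otimes> (x \<otimes> g) = g \<otimes> x"
  shows "w \<in> L"
proof -
  interpret L: normal L G by fact
  have x: "x \<in> carrier G" using assms by auto
  have "w \<otimes> x \<otimes> g = g \<otimes> x" using assms x by (simp add: m_assoc)
  then have "w \<otimes> x = g \<otimes> x \<otimes> inv g"
    using assms(3,4) x by (metis inv_solve_right m_closed)
  then have "w = (g \<otimes> x \<otimes> inv g) \<otimes> inv x"
    using assms(3,4) x by (metis inv_solve_right m_closed)
  moreover have "g \<otimes> x \<otimes> inv g \<in> L"
    using assms by (simp add: L.inv_op_closed2)
  ultimately show ?thesis using assms(2) by simp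
qed

section \<open>A primitive root of unity\<close>

definition zeta_pow :: "nat \<Rightarrow> int \<Rightarrow> complex" where
  "zeta_pow p k = cis (2 * pi * (real_of_int k / real p))"

lemma zeta_pow_0 [simp]: "zeta_pow p 0 = 1"
  by (simp add: zeta_pow_def)

lemma zeta_pow_nonzero [simp]: "zeta_pow p k \<noteq> 0"
  by (simp add: zeta_pow_def)

lemma zeta_pow_add: "zeta_pow p (k + l) = zeta_pow p k * zeta_pow p l"
  by (simp add: zeta_pow_def cis_mult add_divide_distrib ring_distribs)

lemma zeta_pow_eq_1_iff:
  assumes "p > 0"
  shows "zeta_pow p k = 1 \<longleftrightarrow> int p dvd k"
proof
  assume "zeta_pow p k = 1"
  then have "cos (2 * pi * (real_of_int k / real p)) = 1"
    by (simp add: zeta_pow_def complex_eq_iff)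
  then obtain n :: int where "2 * pi * (real_of_int k / real p) = n * 2 * pi"
    by (auto simp: cos_one_2pi_int)
  then have "real_of_int k = real_of_int (n * int p)"
    using assms by (simp add: field_simps)
  then have "k = n * int p" by (simp only: of_int_eq_iff)
  then show "int p dvd k" by simp
next
  assume "int p dvd k"
  then obtain n where "k = int p * n" by blast
  then show "zeta_pow p k = 1"
    using assms by (simp add: zeta_pow_def)
qed

lemma zeta_pow_eq_iff:
  assumes "p > 0"
  shows "zeta_pow p k = zeta_pow p l \<longleftrightarrow> k mod int p = l mod int p"
proof -
  have "zeta_pow p k = zeta_pow p (k - l) * zeta_pow p l"
    by (simp flip: zeta_pow_add)
  then have "zeta_pow p k = zeta_pow p l \<longleftrightarrow> zeta_pow p (k - l) = 1" by simp
  also have "\<dots> \<longleftrightarrow> k mod int p = l mod int p"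
    using assms by (simp add: zeta_pow_eq_1_iff mod_eq_dvd_iff)
  finally show ?thesis .
qed

section \<open>The group\<close>

text \<open>
  A tuple lists the coordinates \<open>s\<close>, \<open>a\<^sub>1\<close>, \<open>a\<^sub>2\<close>, \<open>b\<^sub>1\<close>, \<open>b\<^sub>2\<close>, \<open>t\<close>, \<open>u\<^sub>1\<close>, \<open>u\<^sub>2\<close>.  The entries are
  arbitrary integers; the group elements are the tuples of residues in \<open>{0..<p}\<close>.
\<close>
type_synonym coords = "int \<times> int \<times> int \<times> int \<times> int \<times> int \<times> int \<times> int"

abbreviation coords_zero :: coords where
  "coords_zero \<equiv> (0, 0, 0, 0, 0, 0, 0, 0)"

definition residues8 :: "nat \<Rightarrow> coords set" where
  "residues8 p = {0..<int p} \<times> {0..<int p} \<times> {0..<int p} \<times> {0..<int p} \<times>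
    {0..<int p} \<times> {0..<int p} \<times> {0..<int p} \<times> {0..<int p}"

fun reduce :: "nat \<Rightarrow> coords \<Rightarrow> coords" where
  "reduce p (s, a1, a2, b1, b2, t, u1, u2) =
    (s mod int p, a1 mod int p, a2 mod int p, b1 mod int p, b2 mod int p,
     t mod int p, u1 mod int p, u2 mod int p)"

text \<open>
  Multiplication, inversion and the cocycle are given by polynomials with integral coefficients.
  Their identities hold over \<open>\<int>\<close> and pass to the residues.
\<close>
fun coords_mult :: "coords \<Rightarrow> coords \<Rightarrow> coords" where
  "coords_mult (s, a1, a2, b1, b2, t, u1, u2) (s', a1', a2', b1', b2', t', u1', u2') =
    (s + s', a1 + a1', a2 + a2', b1 + b1', b2 + b2', t + t' + a1 * b1' + a2 * b2',
     u1 + u1' + s * a1', u2 + u2' + s * a2')"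

fun coords_inv :: "coords \<Rightarrow> coords" where
  "coords_inv (s, a1, a2, b1, b2, t, u1, u2) =
    (- s, - a1, - a2, - b1, - b2, a1 * b1 + a2 * b2 - t, s * a1 - u1, s * a2 - u2)"

fun coords_cocycle :: "coords \<Rightarrow> coords \<Rightarrow> int" where
  "coords_cocycle (s, a1, a2, b1, b2, t, u1, u2) (s', a1', a2', b1', b2', t', u1', u2') =
    s * t' + u1 * b1' + u2 * b2' + a1 * a2'"

lemma coords_cases:
  obtains s a1 a2 b1 b2 t u1 u2 where "(x :: coords) = (s, a1, a2, b1, b2, t, u1, u2)"
  by (metis prod.exhaust)

lemma coords_mult_assoc: "coords_mult (coords_mult x y) z = coords_mult x (coords_mult y z)"
  by (cases x rule: coords_cases; cases y rule: coords_cases; cases z rule: coords_cases)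
     (simp add: algebra_simps)

lemma coords_0_mult: "coords_mult coords_zero x = x"
  by (cases x rule: coords_cases) simp

lemma coords_inv_mult: "coords_mult (coords_inv x) x = coords_zero"
  by (cases x rule: coords_cases) simp

lemma coords_cocycle_eq:
  "coords_cocycle x y + coords_cocycle (coords_mult x y) z =
   coords_cocycle x (coords_mult y z) + coords_cocycle y z"
  by (cases x rule: coords_cases; cases y rule: coords_cases; cases z rule: coords_cases)
     (simp add: algebra_simps)

lemma reduce_mult_reduce:
  "reduce p (coords_mult (reduce p x) y) = reduce p (coords_mult x y)"
  "reduce p (coords_mult x (reduce p y)) = reduce p (coords_mult x y)"
  by (cases x rule: coords_cases; cases y rule: coords_cases;
      simp; intro conjI mod_add_cong mod_mult_cong; simp add: mod_simps)+

lemma coords_cocycle_reduce: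
  "coords_cocycle (reduce p x) y mod int p = coords_cocycle x y mod int p"
  "coords_cocycle x (reduce p y) mod int p = coords_cocycle x y mod int p"
  by (cases x rule: coords_cases; cases y rule: coords_cases;
      simp; intro mod_add_cong mod_mult_cong; simp)+

lemma reduce_residues8: "x \<in> residues8 p \<Longrightarrow> reduce p x = x"
  by (cases x rule: coords_cases) (simp add: residues8_def)

text \<open>
  Tuples of integers are countable, so \<open>to_nat\<close> carries the group over to natural numbers.
\<close>
definition symplectic_group :: "nat \<Rightarrow> nat monoid" where
  "symplectic_group p =
    \<lparr>carrier = to_nat ` residues8 p,
     monoid.mult = (\<lambda>x y. to_nat (reduce p (coords_mult (from_nat x) (from_nat y)))),
     one = to_nat coords_zero\<rparr>"

definition symplectic_cocycle :: "nat \<Rightarrow> nat \<times> nat \<Rightarrow> complex" where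
  "symplectic_cocycle p =
    restrict (\<lambda>(x, y). zeta_pow p (coords_cocycle (from_nat x) (from_nat y)))
      (carrier (symplectic_group p) \<times> carrier (symplectic_group p))"

context
  fixes p :: nat
  assumes p_gt_1: "1 < p"
begin

lemma carrier_symplectic: "carrier (symplectic_group p) = to_nat ` residues8 p"
  by (simp add: symplectic_group_def)

lemma mem_carrier_symplectic [simp]:
  "to_nat (x :: coords) \<in> carrier (symplectic_group p) \<longleftrightarrow> x \<in> residues8 p"
  by (simp add: carrier_symplectic inj_image_mem_iff)

lemma one_symplectic [simp]: "\<one>\<^bsub>symplectic_group p\<^esub> = to_nat coords_zero"
  by (simp add: symplectic_group_def)

lemma mult_symplectic [simp]:
  "to_nat x \<otimes>\<^bsub>symplectic_group p\<^esub> to_nat y = to_nat (reduce p (coords_mult x y))"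
  by (simp add: symplectic_group_def)

lemma reduce_in_residues8 [simp]: "reduce p x \<in> residues8 p"
  using p_gt_1 by (cases x rule: coords_cases) (simp add: residues8_def)

lemma group_symplectic: "group (symplectic_group p)"
proof (rule groupI)
  fix x y z
  assume "x \<in> carrier (symplectic_group p)" "y \<in> carrier (symplectic_group p)"
    "z \<in> carrier (symplectic_group p)"
  then obtain X Y Z :: coords where "x = to_nat X" "y = to_nat Y" "z = to_nat Z"
    unfolding carrier_symplectic by blast
  then show "x \<otimes>\<^bsub>symplectic_group p\<^esub> y \<otimes>\<^bsub>symplectic_group p\<^esub> z =
      x \<otimes>\<^bsub>symplectic_group p\<^esub> (y \<otimes>\<^bsub>symplectic_group p\<^esub> z)"
    by (simp add: reduce_mult_reduce coords_mult_assoc)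
next
  fix x assume "x \<in> carrier (symplectic_group p)"
  then obtain X :: coords where "x = to_nat X" "X \<in> residues8 p"
    unfolding carrier_symplectic by blast
  then show "\<one>\<^bsub>symplectic_group p\<^esub> \<otimes>\<^bsub>symplectic_group p\<^esub> x = x"
    and "\<exists>y\<in>carrier (symplectic_group p).
      y \<otimes>\<^bsub>symplectic_group p\<^esub> x = \<one>\<^bsub>symplectic_group p\<^esub>"
    by (auto simp: coords_0_mult coords_inv_mult reduce_mult_reduce reduce_residues8
        intro!: bexI[of _ "to_nat (reduce p (coords_inv X))"])
next
  show "\<one>\<^bsub>symplectic_group p\<^esub> \<in> carrier (symplectic_group p)"
    using p_gt_1 by (simp add: residues8_def)
next
  fix x y assume "x \<in> carrier (symplectic_group p)" "y \<in> carrier (symplectic_group p)"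
  then obtain X Y :: coords where "x = to_nat X" "y = to_nat Y"
    unfolding carrier_symplectic by blast
  then show "x \<otimes>\<^bsub>symplectic_group p\<^esub> y \<in> carrier (symplectic_group p)"
    by (simp only: mult_symplectic mem_carrier_symplectic reduce_in_residues8)
qed

interpretation group "symplectic_group p"
  by (rule group_symplectic)

lemma inv_symplectic:
  assumes "x \<in> residues8 p"
  shows "inv\<^bsub>symplectic_group p\<^esub> to_nat x = to_nat (reduce p (coords_inv x))"
  by (rule inv_equality) (simp_all add: assms coords_inv_mult reduce_mult_reduce)

lemma order_symplectic: "order (symplectic_group p) = p ^ 8"
  by (simp add: order_def carrier_symplectic card_image residues8_def card_cartesian_product
      eval_nat_numeral)

section \<open>The cocycle\<close>

lemma symplectic_cocycle_apply:
  assumes "x \<in> residues8 p" "y \<in> residues8 p"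
  shows "symplectic_cocycle p (to_nat x, to_nat y) = zeta_pow p (coords_cocycle x y)"
  using assms by (simp add: symplectic_cocycle_def)

lemma symplectic_cocycle_eq_iff:
  assumes "x \<in> residues8 p" "y \<in> residues8 p"
  shows "symplectic_cocycle p (to_nat x, to_nat y) = symplectic_cocycle p (to_nat y, to_nat x) \<longleftrightarrow>
    coords_cocycle x y mod int p = coords_cocycle y x mod int p"
  using assms p_gt_1 by (simp add: symplectic_cocycle_apply zeta_pow_eq_iff)

lemma symplectic_cocycle_in_cocycles2: "symplectic_cocycle p \<in> cocycles2 (symplectic_group p)"
proof -
  have "symplectic_cocycle p \<in> carrier (cochain_group2 (symplectic_group p))"
    by (auto simp: cochain_group2_def symplectic_cocycle_def)
  moreover have "zeta_pow p (coords_cocycle x y) * zeta_pow p (coords_cocycle (reduce p (coords_mult x y)) z) =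
      zeta_pow p (coords_cocycle x (reduce p (coords_mult y z))) * zeta_pow p (coords_cocycle y z)"
    for x y z
  proof -
    have "zeta_pow p (coords_cocycle (reduce p (coords_mult x y)) z) =
        zeta_pow p (coords_cocycle (coords_mult x y) z)"
      and "zeta_pow p (coords_cocycle x (reduce p (coords_mult y z))) =
        zeta_pow p (coords_cocycle x (coords_mult y z))"
      using p_gt_1 by (simp_all add: zeta_pow_eq_iff coords_cocycle_reduce)
    then show ?thesis
      by (simp add: coords_cocycle_eq flip: zeta_pow_add)
  qed
  ultimately show ?thesis
    by (auto simp: cocycles2_def carrier_symplectic symplectic_cocycle_apply
        simp del: mem_carrier_symplectic)
qed

lemma ex_commuting_unit_vector:
  assumes "x \<in> residues8 p" "x \<noteq> coords_zero"
  shows "\<exists>y\<in>residues8 p. coords_mult x y = coords_mult y x \<and>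
    coords_cocycle x y mod int p \<noteq> coords_cocycle y x mod int p"
proof (cases x rule: coords_cases)
  case 0: (1 s a1 a2 b1 b2 t u1 u2)
  \<comment> \<open>The coordinates are examined in the order \<open>s\<close>, \<open>b\<close>, \<open>a\<close>, \<open>t\<close>, \<open>u\<close>.  The unit vectors dual to \<open>s\<close> and
      \<open>b\<close> are central; those dual to \<open>a\<close> commute with \<open>x\<close> if \<open>s = b = 0\<close>, and those dual to \<open>t\<close> and
      \<open>u\<close> do so if \<open>a = 0\<close>.\<close>
  have nz: "k mod int p \<noteq> 0" "(- k) mod int p \<noteq> 0" if "k \<in> {0..<int p}" "k \<noteq> 0" for k
    using that by (auto simp: zmod_zminus1_eq_if)
  have range: "s \<in> {0..<int p}" "a1 \<in> {0..<int p}" "a2 \<in> {0..<int p}" "b1 \<in> {0..<int p}"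
      "b2 \<in> {0..<int p}" "t \<in> {0..<int p}" "u1 \<in> {0..<int p}" "u2 \<in> {0..<int p}"
    using assms(1) by (auto simp: 0 residues8_def)
  consider "s \<noteq> 0" | "b1 \<noteq> 0" | "b2 \<noteq> 0" | "s = 0" "b1 = 0" "b2 = 0" "a1 \<noteq> 0"
    | "s = 0" "b1 = 0" "b2 = 0" "a2 \<noteq> 0"
    | "s = 0" "b1 = 0" "b2 = 0" "a1 = 0" "a2 = 0" "t \<noteq> 0"
    | "s = 0" "b1 = 0" "b2 = 0" "a1 = 0" "a2 = 0" "u1 \<noteq> 0"
    | "s = 0" "b1 = 0" "b2 = 0" "a1 = 0" "a2 = 0" "u2 \<noteq> 0"
    using assms(2) 0 by auto
  then show ?thesis
  proof cases
    case 1
    with range nz p_gt_1 show ?thesis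
      by (intro bexI[of _ "(0, 0, 0, 0, 0, 1, 0, 0)"]) (simp_all add: 0 residues8_def add.commute)
  next
    case 2
    with range nz p_gt_1 show ?thesis
      by (intro bexI[of _ "(0, 0, 0, 0, 0, 0, 1, 0)"]) (simp_all add: 0 residues8_def add.commute)
  next
    case 3
    with range nz p_gt_1 show ?thesis
      by (intro bexI[of _ "(0, 0, 0, 0, 0, 0, 0, 1)"]) (simp_all add: 0 residues8_def add.commute)
  next
    case 4
    with range nz p_gt_1 show ?thesis
      by (intro bexI[of _ "(0, 0, 1, 0, 0, 0, 0, 0)"]) (simp_all add: 0 residues8_def add.commute)
  next
    case 5
    with range nz p_gt_1 show ?thesis
      by (intro bexI[of _ "(0, 1, 0, 0, 0, 0, 0, 0)"]) (simp_all add: 0 residues8_def add.commute)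
  next
    case 6
    with range nz p_gt_1 show ?thesis
      by (intro bexI[of _ "(1, 0, 0, 0, 0, 0, 0, 0)"]) (simp_all add: 0 residues8_def add.commute)
  next
    case 7
    with range nz p_gt_1 show ?thesis
      by (intro bexI[of _ "(0, 0, 0, 1, 0, 0, 0, 0)"]) (simp_all add: 0 residues8_def add.commute)
  next
    case 8
    with range nz p_gt_1 show ?thesis
      by (intro bexI[of _ "(0, 0, 0, 0, 1, 0, 0, 0)"]) (simp_all add: 0 residues8_def add.commute)
  qed
qed

lemma nondegenerate_symplectic: "nondegenerate (symplectic_group p) (symplectic_cocycle p)"
  unfolding nondegenerate_def
proof (intro ballI impI)
  fix x assume "x \<in> carrier (symplectic_group p)" "x \<noteq> \<one>\<^bsub>symplectic_group p\<^esub>"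
  then obtain X :: coords where X: "x = to_nat X" "X \<in> residues8 p" "X \<noteq> coords_zero"
    unfolding carrier_symplectic by auto
  then obtain Y where Y: "Y \<in> residues8 p" "coords_mult X Y = coords_mult Y X"
      "coords_cocycle X Y mod int p \<noteq> coords_cocycle Y X mod int p"
    using ex_commuting_unit_vector by blast
  show "\<exists>g\<in>group_centralizer (symplectic_group p) x.
      symplectic_cocycle p (x, g) \<noteq> symplectic_cocycle p (g, x)"
    using X Y
    by (intro bexI[of _ "to_nat Y"]) (auto simp: group_centralizer_def symplectic_cocycle_eq_iff)
qed

section \<open>The two normal isotropic subgroups\<close>

definition Lagrangian_coords :: "coords set" where
  "Lagrangian_coords = residues8 p \<inter> {(s, a1, a2, b1, b2, t, u1, u2). s = 0 \<and> a2 = 0 \<and> b1 = 0 \<and> b2 = 0}"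

definition span_e_coords :: "coords set" where
  "span_e_coords = residues8 p \<inter>
    {(s, a1, a2, b1, b2, t, u1, u2). s = 0 \<and> a1 = 0 \<and> a2 = 0 \<and> u1 = 0 \<and> u2 = 0}"

lemma normal_isotropic_image:
  assumes S: "S \<subseteq> residues8 p" "coords_zero \<in> S"
    and mult: "\<And>x y. x \<in> S \<Longrightarrow> y \<in> S \<Longrightarrow> reduce p (coords_mult x y) \<in> S"
    and inv: "\<And>x. x \<in> S \<Longrightarrow> reduce p (coords_inv x) \<in> S"
    and conj: "\<And>g x. g \<in> residues8 p \<Longrightarrow> x \<in> S \<Longrightarrow> 
      \<exists>x'\<in>S. reduce p (coords_mult g x) = reduce p (coords_mult x' g)"
    and zero: "\<And>x y. x \<in> S \<Longrightarrow> y \<in> S \<Longrightarrow> coords_cocycle x y = 0"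
  shows "to_nat ` S \<lhd> symplectic_group p"
    and "isotropic (symplectic_group p) (cohomology_class (symplectic_group p) (symplectic_cocycle p))
      (to_nat ` S)"
proof -
  have sub: "subgroup (to_nat ` S) (symplectic_group p)"
  proof (rule subgroupI)
    show "to_nat ` S \<subseteq> carrier (symplectic_group p)" "to_nat ` S \<noteq> {}"
      using S by (auto simp: carrier_symplectic)
  next
    fix x assume "x \<in> to_nat ` S"
    then obtain X :: coords where "x = to_nat X" "X \<in> S" by blast
    then show "inv\<^bsub>symplectic_group p\<^esub> x \<in> to_nat ` S"
      using S(1) inv[of X] inv_symplectic[of X] by auto
  next
    fix x y assume "x \<in> to_nat ` S" "y \<in> to_nat ` S"
    then show "x \<otimes>\<^bsub>symplectic_group p\<^esub> y \<in> to_nat ` S"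
      using mult by auto
  qed
  show "to_nat ` S \<lhd> symplectic_group p"
  proof (rule normal_if_conjugation_closed[OF sub])
    fix g x assume "g \<in> carrier (symplectic_group p)" "x \<in> to_nat ` S"
    then obtain X :: coords where "x = to_nat X" "X \<in> S" by blast
    moreover obtain K :: coords where "g = to_nat K" "K \<in> residues8 p"
      using \<open>g \<in> carrier (symplectic_group p)\<close> unfolding carrier_symplectic by blast
    ultimately show "\<exists>h'\<in>to_nat ` S. g \<otimes>\<^bsub>symplectic_group p\<^esub> x = h' \<otimes>\<^bsub>symplectic_group p\<^esub> g"
      using conj[of K X] by auto
  qed
  show "isotropic (symplectic_group p) (cohomology_class (symplectic_group p) (symplectic_cocycle p))
      (to_nat ` S)"
    using S(1) zero
    by (intro isotropic_if_trivial_on symplectic_cocycle_in_cocycles2 sub)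
       (auto simp: symplectic_cocycle_apply subset_iff)
qed

lemma Lagrangian_coords_normal_isotropic:
  "to_nat ` Lagrangian_coords \<lhd> symplectic_group p"
  "isotropic (symplectic_group p) (cohomology_class (symplectic_group p) (symplectic_cocycle p))
    (to_nat ` Lagrangian_coords)"
proof -
  have conj: "\<exists>x'\<in>Lagrangian_coords. reduce p (coords_mult g x) = reduce p (coords_mult x' g)"
    if x: "x \<in> Lagrangian_coords" for g x
  proof -
    obtain s a1 a2 b1 b2 t u1 u2 where g: "g = (s, a1, a2, b1, b2, t, u1, u2)"
      by (rule coords_cases)
    obtain xa xt xu1 xu2 where x: "x = (0, xa, 0, 0, 0, xt, xu1, xu2)" "xa \<in> {0..<int p}"
      using x by (auto simp: Lagrangian_coords_def residues8_def)
    \<comment> \<open>This is \<open>g x g\<inverse>\<close>: the class is 2, so it differs from \<open>x\<close> by the commutator of \<open>g\<close> and \<open>x\<close>,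
        which is bilinear in the generator coordinates.\<close>
    let ?y = "(0, xa, 0, 0, 0, xt - xa * b1, xu1 + s * xa, xu2)"
    have "reduce p ?y \<in> Lagrangian_coords"
      using p_gt_1 x(2) by (simp add: Lagrangian_coords_def residues8_def)
    moreover have "reduce p (coords_mult g x) = reduce p (coords_mult (reduce p ?y) g)"
      unfolding reduce_mult_reduce by (simp add: x g algebra_simps)
    ultimately show ?thesis by blast
  qed
  show "to_nat ` Lagrangian_coords \<lhd> symplectic_group p"
    "isotropic (symplectic_group p) (cohomology_class (symplectic_group p) (symplectic_cocycle p))
      (to_nat ` Lagrangian_coords)"
    using p_gt_1
    by (intro normal_isotropic_image conj;
        auto simp: Lagrangian_coords_def residues8_def)+
qed

lemma span_e_coords_normal_isotropic:
  "to_nat ` span_e_coords \<lhd> symplectic_group p"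
  "isotropic (symplectic_group p) (cohomology_class (symplectic_group p) (symplectic_cocycle p))
    (to_nat ` span_e_coords)"
proof -
  have conj: "\<exists>x'\<in>span_e_coords. reduce p (coords_mult g x) = reduce p (coords_mult x' g)"
    if x: "x \<in> span_e_coords" for g x
  proof -
    obtain s a1 a2 b1 b2 t u1 u2 where g: "g = (s, a1, a2, b1, b2, t, u1, u2)"
      by (rule coords_cases)
    obtain xb1 xb2 xt where x: "x = (0, 0, 0, xb1, xb2, xt, 0, 0)"
        "xb1 \<in> {0..<int p}" "xb2 \<in> {0..<int p}"
      using x by (auto simp: span_e_coords_def residues8_def)
    let ?y = "(0, 0, 0, xb1, xb2, xt + a1 * xb1 + a2 * xb2, 0, 0)"
    have "reduce p ?y \<in> span_e_coords"
      using p_gt_1 x(2,3) by (simp add: span_e_coords_def residues8_def)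
    moreover have "reduce p (coords_mult g x) = reduce p (coords_mult (reduce p ?y) g)"
      unfolding reduce_mult_reduce by (simp add: x g algebra_simps)
    ultimately show ?thesis by blast
  qed
  show "to_nat ` span_e_coords \<lhd> symplectic_group p"
    "isotropic (symplectic_group p) (cohomology_class (symplectic_group p) (symplectic_cocycle p))
      (to_nat ` span_e_coords)"
    using p_gt_1
    by (intro normal_isotropic_image conj;
        auto simp: span_e_coords_def residues8_def)+
qed

lemma card_Lagrangian_coords: "card (to_nat ` Lagrangian_coords) = p ^ 4"
proof -
  let ?R = "{0..<int p}"
  have "Lagrangian_coords = {0} \<times> ?R \<times> {0} \<times> {0} \<times> {0} \<times> ?R \<times> ?R \<times> ?R"
    using p_gt_1 by (auto simp: Lagrangian_coords_def residues8_def)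
  then show ?thesis by (simp add: card_image card_cartesian_product eval_nat_numeral)
qed

lemma card_span_e_coords: "card (to_nat ` span_e_coords) = p ^ 3"
proof -
  let ?R = "{0..<int p}"
  have "span_e_coords = {0} \<times> {0} \<times> {0} \<times> ?R \<times> ?R \<times> ?R \<times> {0} \<times> {0}"
    using p_gt_1 by (auto simp: span_e_coords_def residues8_def)
  then show ?thesis by (simp add: card_image card_cartesian_product eval_nat_numeral)
qed

text \<open>
  Pairing with \<open>e\<^sub>1\<close>, \<open>e\<^sub>2\<close>, \<open>e\<^sub>3\<close> makes \<open>s\<close>, then \<open>a\<close>, then \<open>u\<close> vanish on \<open>L\<close>.  The middle step pairs the
  commutator \<open>[z, x]\<close>, which lies in \<open>L\<close> by normality, in place of \<open>x\<close> itself.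
\<close>
lemma normal_isotropic_above_span_e:
  assumes L: "L \<lhd> symplectic_group p"
    and iso: "isotropic (symplectic_group p)
      (cohomology_class (symplectic_group p) (symplectic_cocycle p)) L"
    and sub: "to_nat ` span_e_coords \<subseteq> L"
  shows "L \<subseteq> to_nat ` span_e_coords"
proof
  fix l assume l: "l \<in> L"
  have "L \<subseteq> carrier (symplectic_group p)"
    using iso by (auto simp: isotropic_def dest: subgroup.subset)
  then obtain x where lx: "l = to_nat x" and x: "x \<in> residues8 p"
    using l unfolding carrier_symplectic by blast
  obtain s a1 a2 b1 b2 t u1 u2 where xc: "x = (s, a1, a2, b1, b2, t, u1, u2)"
    by (rule coords_cases)
  have range: "s \<in> {0..<int p}" "a1 \<in> {0..<int p}" "a2 \<in> {0..<int p}"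
      "u1 \<in> {0..<int p}" "u2 \<in> {0..<int p}"
    using x by (auto simp: xc residues8_def)
  have xL: "to_nat x \<in> L" using l lx by simp
  let ?e1 = "(0, 0, 0, 1, 0, 0, 0, 0) :: coords" and ?e2 = "(0, 0, 0, 0, 1, 0, 0, 0) :: coords"
    and ?e3 = "(0, 0, 0, 0, 0, 1, 0, 0) :: coords" and ?z = "(1, 0, 0, 0, 0, 0, 0, 0) :: coords"
  have e: "to_nat ?e1 \<in> L" "to_nat ?e2 \<in> L" "to_nat ?e3 \<in> L"
    using sub p_gt_1 by (auto simp: span_e_coords_def residues8_def image_subset_iff)
  have sym: "coords_cocycle v w mod int p = coords_cocycle w v mod int p"
    if "to_nat v \<in> L" "to_nat w \<in> L" "coords_mult v w = coords_mult w v" for v w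
  proof -
    have "v \<in> residues8 p" "w \<in> residues8 p"
      using that \<open>L \<subseteq> carrier (symplectic_group p)\<close> mem_carrier_symplectic by blast+
    with isotropic_imp_symmetric_on_commuting[OF symplectic_cocycle_in_cocycles2 iso that(1,2)]
    show ?thesis using that(3) by (simp add: symplectic_cocycle_eq_iff)
  qed
  have s: "s = 0"
    using sym[OF xL e(3)] range by (simp add: xc)
  \<comment> \<open>This is the commutator of \<open>z\<close> and \<open>x\<close>.\<close>
  let ?w = "(0, 0, 0, 0, 0, 0, a1, a2) :: coords"
  have w: "to_nat ?w \<in> L"
    by (rule commutator_in_normal[OF L xL, of "to_nat ?z"])
       (use p_gt_1 range in \<open>auto simp: xc s residues8_def algebra_simps\<close>)
  have a: "a1 = 0" "a2 = 0"
    using sym[OF w e(1)] sym[OF w e(2)] range by simp_all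
  have u: "u1 = 0" "u2 = 0"
    using sym[OF xL e(1)] sym[OF xL e(2)] range by (simp_all add: xc s a add.commute)
  show "l \<in> to_nat ` span_e_coords"
    using x by (simp add: lx xc s a u span_e_coords_def inj_image_mem_iff)
qed

end

theorem proposition1p10:
  fixes p :: nat
  assumes "Factorial_Ring.prime p" and "p \<ge> 3"
  shows "\<exists>(G :: nat monoid) c.
    group G \<and> Coset.order G = p ^ 8 \<and>
    c \<in> carrier (Z2 G) \<and> nondegenerate G c \<and>
    (\<exists>H. normal_Lagrangian G (cohomology_class G c) H \<and> card H = p ^ 4) \<and>
    (\<exists>N. N \<lhd> G \<and> isotropic G (cohomology_class G c) N \<and> card N = p ^ 3 \<and>
      \<not> (\<exists>L. normal_Lagrangian G (cohomology_class G c) L \<and> N \<subseteq> L))"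
proof -
  have p: "1 < p" using assms(2) by simp
  let ?G = "symplectic_group p" and ?c = "symplectic_cocycle p"
  let ?H = "to_nat ` Lagrangian_coords p :: nat set" and ?N = "to_nat ` span_e_coords p :: nat set"
  have Lagrangian_iff: "Lagrangian ?G \<gamma> L \<longleftrightarrow> isotropic ?G \<gamma> L \<and> card L = p ^ 4" for \<gamma> L
  proof -
    have "sqrt (real (Coset.order ?G)) = sqrt ((real p ^ 4) ^ 2)"
      by (simp add: order_symplectic[OF p] flip: power_mult)
    also have "\<dots> = real (p ^ 4)" by (simp only: real_sqrt_abs) simp
    finally show ?thesis by (simp only: Lagrangian_def of_nat_eq_iff)
  qed
  have no_L: "\<not> (normal_Lagrangian ?G (cohomology_class ?G ?c) L \<and> ?N \<subseteq> L)" for L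
  proof
    assume L: "normal_Lagrangian ?G (cohomology_class ?G ?c) L \<and> ?N \<subseteq> L"
    then have "L = ?N"
      using normal_isotropic_above_span_e[OF p, of L]
      by (auto simp: normal_Lagrangian_def Lagrangian_def)
    with L show False
      using p by (simp add: normal_Lagrangian_def Lagrangian_iff card_span_e_coords)
  qed
  show ?thesis
  proof (intro exI conjI)
    show "normal_Lagrangian ?G (cohomology_class ?G ?c) ?H"
      using p by (simp add: normal_Lagrangian_def Lagrangian_iff card_Lagrangian_coords
          Lagrangian_coords_normal_isotropic)
    show "\<not> (\<exists>L. normal_Lagrangian ?G (cohomology_class ?G ?c) L \<and> ?N \<subseteq> L)"
      using no_L by blast
  qed (use p in \<open>simp_all add: group_symplectic order_symplectic carrier_Z2
      symplectic_cocycle_in_cocycles2 nondegenerate_symplectic card_Lagrangian_coords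
      card_span_e_coords span_e_coords_normal_isotropic\<close>)
qed

end
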